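(* Let $G$ be a Lie group acting on a manifold $M$. Then the classifying space $B\mathcal{G}$ of the action groupoid $\mathcal{G}:=G\ltimes M$ is homotopy equivalent to the Borel construction $EG\times_G M$.
   Context: The action groupoid $G\ltimes M$ is the Lie groupoid with objects $M$, arrows $G\times M$, source $s(g,x)=x$, target $t(g,x)=g\cdot x$, and composition of the arrow $(g_1,x)$ followed by $(g_2,g_1\cdot x)$ equal to $(g_2g_1,x)$. For a Lie groupoid $\mathcal G=(G_1\rightrightarrows G_0)$, the nerve $N\mathcal G$ is the simplicial manifold $(G^{(n)})_{n\ge0}$ with $G^{(0)}=G_0$, $G^{(1)}=G_1$ and, for $n>1$, $G^{(n)}$ the $n$-fold fibred product of $G_1$ over $s$ and $t$ (strings of $n$ composable arrows), with the usual face maps (dropping the first or last arrow, or composing two consecutive arrows; source and target when $n=1$) and degeneracy maps (inserting a unit arrow). The classifying space $B\mathcal G$ is the geometric realisation $\left(\coprod_{n}\Delta^n\times G^{(n)}\right)/\!\sim$, where $\Delta^n$ is the standard $n$-simplex and $\sim$ is generated by the identifications for both the face maps and the degeneracy maps. $EG$ is the contractible total space of the universal principal $G$-bundle $EG\to BG$ (the paper uses as a model the classifying space of the pair groupoid $G\times G\rightrightarrows G$, with the free $G$-action induced by $g\cdot g_1=g_1g^{-1}$ on objects), and $EG\times_GM$ is the quotient of $EG\times M$ by the diagonal action of $G$. *)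

theory Defs
  imports "HOL-Analysis.Analysis" "HOL-Homology.Homology" "HOL-Algebra.Group_Action"
begin

section \<open>Smooth manifolds, Lie groups and smooth actions\<close>

text \<open>
  Charts take values in \<^term>\<open>Euclidean_space n\<close>, i.e. in those \<^typ>\<open>nat \<Rightarrow> real\<close> that vanish
  from index \<open>n\<close> on. In this way the dimension is a value and may be \<open>0\<close>, so that discrete Lie
  groups are included (every \<open>euclidean_space\<close> type has positive dimension).
\<close>

definition partial_deriv :: "nat \<Rightarrow> ((nat \<Rightarrow> real) \<Rightarrow> real) \<Rightarrow> (nat \<Rightarrow> real) \<Rightarrow> real" where
  "partial_deriv i f x = deriv (\<lambda>t. f (x(i := t))) (x i)"

text \<open>Only used for \<open>S\<close> open in \<^term>\<open>Euclidean_space n\<close>.\<close>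

primrec Ck_on :: "nat \<Rightarrow> nat \<Rightarrow> (nat \<Rightarrow> real) set \<Rightarrow> ((nat \<Rightarrow> real) \<Rightarrow> real) \<Rightarrow> bool" where
  "Ck_on 0 n S f \<longleftrightarrow> continuous_map (subtopology (Euclidean_space n) S) euclideanreal f"
| "Ck_on (Suc k) n S f \<longleftrightarrow>
     continuous_map (subtopology (Euclidean_space n) S) euclideanreal f \<and>
     (\<forall>i<n. (\<forall>x\<in>S. (\<lambda>t. f (x(i := t))) differentiable at (x i)) \<and>
            Ck_on k n S (partial_deriv i f))"

definition smooth_on :: "nat \<Rightarrow> nat \<Rightarrow> (nat \<Rightarrow> real) set \<Rightarrow> ((nat \<Rightarrow> real) \<Rightarrow> nat \<Rightarrow> real) \<Rightarrow> bool" where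
  "smooth_on n m S f \<longleftrightarrow> (\<forall>k. \<forall>j<m. Ck_on k n S (\<lambda>x. f x j))"

type_synonym 'a chart = "'a set \<times> ('a \<Rightarrow> nat \<Rightarrow> real)"

record 'a manifold =
  mtop :: "'a topology"
  mdim :: nat
  atlas :: "'a chart set"

definition is_chart :: "'a topology \<Rightarrow> nat \<Rightarrow> 'a chart \<Rightarrow> bool" where
  "is_chart X n = (\<lambda>(U, c). openin X U \<and> openin (Euclidean_space n) (c ` U) \<and>
     homeomorphic_map (subtopology X U) (subtopology (Euclidean_space n) (c ` U)) c)"

locale smooth_manifold =
  fixes M :: "'a manifold"
  assumes Hausdorff: "Hausdorff_space (mtop M)"
    and second_countable: "second_countable (mtop M)"
    and charts: "\<And>C. C \<in> atlas M \<Longrightarrow> is_chart (mtop M) (mdim M) C"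
    and covering: "(\<Union>(U, c)\<in>atlas M. U) = topspace (mtop M)"
    and compatible: "\<And>U c V d. (U, c) \<in> atlas M \<Longrightarrow> (V, d) \<in> atlas M \<Longrightarrow>
      smooth_on (mdim M) (mdim M) (c ` (U \<inter> V)) (d \<circ> inv_into U c)"

definition smooth_map :: "'a manifold \<Rightarrow> 'b manifold \<Rightarrow> ('a \<Rightarrow> 'b) \<Rightarrow> bool" where
  "smooth_map M N f \<longleftrightarrow> continuous_map (mtop M) (mtop N) f \<and>
     (\<forall>(U, c)\<in>atlas M. \<forall>(V, d)\<in>atlas N.
        smooth_on (mdim M) (mdim N) (c ` (U \<inter> f -` V)) (d \<circ> f \<circ> inv_into U c))"

definition prod_chart :: "nat \<Rightarrow> 'a chart \<Rightarrow> 'b chart \<Rightarrow> ('a \<times> 'b) chart" where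
  "prod_chart n = (\<lambda>(U, c) (V, d). (U \<times> V, \<lambda>(x, y) i. if i < n then c x i else d y (i - n)))"

definition prod_manifold :: "'a manifold \<Rightarrow> 'b manifold \<Rightarrow> ('a \<times> 'b) manifold" where
  "prod_manifold M N =
     \<lparr>mtop = prod_topology (mtop M) (mtop N), mdim = mdim M + mdim N,
      atlas = {prod_chart (mdim M) C D | C D. C \<in> atlas M \<and> D \<in> atlas N}\<rparr>"

record 'g smooth_group = "'g monoid" +
  gman :: "'g manifold"

locale lie_group = group G + smooth_manifold "gman G" for G :: "'g smooth_group" (structure) +
  assumes carrier_eq: "topspace (mtop (gman G)) = carrier G"
    and smooth_mult: "smooth_map (prod_manifold (gman G) (gman G)) (gman G) (\<lambda>(g, h). g \<otimes> h)"
    and smooth_inv: "smooth_map (gman G) (gman G) (\<lambda>g. inv g)"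

locale smooth_action = group_action G "topspace (mtop M)" \<phi>
  for G :: "'g smooth_group" (structure) and M :: "'m manifold" and \<phi> :: "'g \<Rightarrow> 'm \<Rightarrow> 'm" +
  assumes smooth: "smooth_map (prod_manifold (gman G) M) M (\<lambda>(g, x). \<phi> g x)"


section \<open>Quotient topologies\<close>

definition quotient_topology :: "'a topology \<Rightarrow> ('a \<Rightarrow> 'b) \<Rightarrow> 'b topology" where
  "quotient_topology X q =
     topology (\<lambda>U. U \<subseteq> q ` topspace X \<and> openin X {x \<in> topspace X. q x \<in> U})"

lemma openin_quotient_topology:
  "openin (quotient_topology X q) U \<longleftrightarrow>
     U \<subseteq> q ` topspace X \<and> openin X {x \<in> topspace X. q x \<in> U}"
proof -
  have "istopology (\<lambda>U. U \<subseteq> q ` topspace X \<and> openin X {x \<in> topspace X. q x \<in> U})"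
  proof (unfold istopology_def, intro conjI allI impI; (elim conjE)?)
    fix S T assume "openin X {x \<in> topspace X. q x \<in> S}" "openin X {x \<in> topspace X. q x \<in> T}"
    then have "openin X ({x \<in> topspace X. q x \<in> S} \<inter> {x \<in> topspace X. q x \<in> T})"
      by (rule openin_Int)
    also have "{x \<in> topspace X. q x \<in> S} \<inter> {x \<in> topspace X. q x \<in> T}
        = {x \<in> topspace X. q x \<in> S \<inter> T}" by auto
    finally show "openin X {x \<in> topspace X. q x \<in> S \<inter> T}" .
  next
    fix \<K> assume "\<forall>K\<in>\<K>. K \<subseteq> q ` topspace X \<and> openin X {x \<in> topspace X. q x \<in> K}"
    then have "openin X (\<Union>K\<in>\<K>. {x \<in> topspace X. q x \<in> K})" by blast
    also have "(\<Union>K\<in>\<K>. {x \<in> topspace X. q x \<in> K}) = {x \<in> topspace X. q x \<in> \<Union>\<K>}" by auto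
    finally show "openin X {x \<in> topspace X. q x \<in> \<Union>\<K>}" .
  qed auto
  then show ?thesis
    by (simp add: quotient_topology_def topology_inverse')
qed

lemma quotient_map_quotient_topology: "quotient_map X (quotient_topology X q) q"
proof -
  have "openin (quotient_topology X q) (q ` topspace X)"
    by (auto simp: openin_quotient_topology intro: openin_subopen[THEN iffD2])
  then have "topspace (quotient_topology X q) = q ` topspace X"
    by (metis openin_quotient_topology openin_subset openin_topspace subset_antisym)
  then show ?thesis
    by (simp add: quotient_map_def openin_quotient_topology)
qed


section \<open>Simplicial spaces and geometric realisation\<close>

text \<open>
  \<open>sface X n k\<close> is the face map \<open>d\<^sub>k\<close> from level \<open>n\<close> to level \<open>n - 1\<close> (for \<open>n \<ge> 1\<close>), and
  \<open>sdegen X n k\<close> is the degeneracy map \<open>s\<^sub>k\<close> from level \<open>n\<close> to level \<open>n + 1\<close>; in both cases \<open>k \<le> n\<close>.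
\<close>

record 'a simplicial_space =
  level :: "nat \<Rightarrow> 'a topology"
  sface :: "nat \<Rightarrow> nat \<Rightarrow> 'a \<Rightarrow> 'a"
  sdegen :: "nat \<Rightarrow> nat \<Rightarrow> 'a \<Rightarrow> 'a"

abbreviation simplex_space :: "nat \<Rightarrow> (nat \<Rightarrow> real) topology" where
  "simplex_space n \<equiv> subtopology (powertop_real UNIV) (standard_simplex n)"

text \<open>The coface maps of the standard simplices are \<^const>\<open>simplical_face\<close>; these are the codegeneracies.\<close>

definition simplicial_degen :: "nat \<Rightarrow> (nat \<Rightarrow> real) \<Rightarrow> nat \<Rightarrow> real" where
  "simplicial_degen k p = (\<lambda>i. if i < k then p i else if i = k then p k + p (Suc k) else p (Suc i))"

definition total_space :: "'a simplicial_space \<Rightarrow> (nat \<times> (nat \<Rightarrow> real) \<times> 'a) topology" where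
  "total_space X = sum_topology (\<lambda>n. prod_topology (simplex_space n) (level X n)) UNIV"

inductive realisation_rel ::
    "'a simplicial_space \<Rightarrow> nat \<times> (nat \<Rightarrow> real) \<times> 'a \<Rightarrow> nat \<times> (nat \<Rightarrow> real) \<times> 'a \<Rightarrow> bool"
  for X :: "'a simplicial_space" where
  face: "p \<in> standard_simplex n \<Longrightarrow> x \<in> topspace (level X (Suc n)) \<Longrightarrow> k \<le> Suc n \<Longrightarrow>
    realisation_rel X (Suc n, simplical_face k p, x) (n, p, sface X (Suc n) k x)"
| degen: "p \<in> standard_simplex (Suc n) \<Longrightarrow> x \<in> topspace (level X n) \<Longrightarrow> k \<le> n \<Longrightarrow>
    realisation_rel X (n, simplicial_degen k p, x) (Suc n, p, sdegen X n k x)"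

definition realisation_class ::
    "'a simplicial_space \<Rightarrow> nat \<times> (nat \<Rightarrow> real) \<times> 'a \<Rightarrow> (nat \<times> (nat \<Rightarrow> real) \<times> 'a) set" where
  "realisation_class X z = {w. equivclp (realisation_rel X) z w}"

definition geometric_realisation ::
    "'a simplicial_space \<Rightarrow> (nat \<times> (nat \<Rightarrow> real) \<times> 'a) set topology" where
  "geometric_realisation X = quotient_topology (total_space X) (realisation_class X)"

text \<open>
  The map of realisations induced by a simplicial map \<open>f\<close>, where \<open>f n\<close> is its component at level \<open>n\<close>.
  All representatives of the class \<open>c\<close> have their image in the same class of \<open>Y\<close>.
\<close>

definition realisation_map ::
    "'b simplicial_space \<Rightarrow> (nat \<Rightarrow> 'a \<Rightarrow> 'b) \<Rightarrow>
     (nat \<times> (nat \<Rightarrow> real) \<times> 'a) set \<Rightarrow> (nat \<times> (nat \<Rightarrow> real) \<times> 'b) set" where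
  "realisation_map Y f c = (\<Union>(n, p, x)\<in>c. realisation_class Y (n, p, f n x))"


section \<open>The nerve and the classifying space of a Lie groupoid\<close>

text \<open>
  The structure maps of a Lie groupoid; inversion is determined by them. The arrow \<open>gcomp \<G> a b\<close> is
  \<open>a\<close> followed by \<open>b\<close>, and is only meaningful if the target of \<open>a\<close> is the source of \<open>b\<close>.
\<close>

record ('o, 'a) lie_groupoid =
  gobj :: "'o manifold"
  garr :: "'a manifold"
  gsrc :: "'a \<Rightarrow> 'o"
  gtgt :: "'a \<Rightarrow> 'o"
  gcomp :: "'a \<Rightarrow> 'a \<Rightarrow> 'a"
  gunit :: "'o \<Rightarrow> 'a"

text \<open>
  All levels of the nerve live in one type: level \<open>0\<close> consists of the \<^term>\<open>Inl x\<close> for objects \<open>x\<close>, and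
  level \<open>n \<ge> 1\<close> of the \<^term>\<open>Inr a\<close> for strings \<open>a 0, \<dots>, a (n - 1)\<close> of composable arrows (each one
  followed by the next), with the topology of the fibred product.
\<close>

type_synonym ('o, 'a) nerve_simplex = "'o + (nat \<Rightarrow> 'a)"

definition composable_strings :: "('o, 'a) lie_groupoid \<Rightarrow> nat \<Rightarrow> (nat \<Rightarrow> 'a) topology" where
  "composable_strings \<G> n =
     subtopology (product_topology (\<lambda>i. mtop (garr \<G>)) {..<n})
       {a. \<forall>i. Suc i < n \<longrightarrow> gtgt \<G> (a i) = gsrc \<G> (a (Suc i))}"

definition nerve_level :: "('o, 'a) lie_groupoid \<Rightarrow> nat \<Rightarrow> ('o, 'a) nerve_simplex topology" where
  "nerve_level \<G> n =
     (if n = 0 then pullback_topology (range Inl) projl (mtop (gobj \<G>))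
      else pullback_topology (range Inr) projr (composable_strings \<G> n))"

text \<open>
  For \<open>n \<ge> 2\<close>, \<open>d\<^sub>0\<close> drops the first arrow, \<open>d\<^sub>n\<close> drops the last one, and the other \<open>d\<^sub>k\<close> compose
  \<open>a (k - 1)\<close> with \<open>a k\<close>.
\<close>

definition nerve_face ::
    "('o, 'a) lie_groupoid \<Rightarrow> nat \<Rightarrow> nat \<Rightarrow> ('o, 'a) nerve_simplex \<Rightarrow> ('o, 'a) nerve_simplex" where
  "nerve_face \<G> n k z =
     (let a = projr z in
      if n = 1 then Inl (if k = 0 then gtgt \<G> (a 0) else gsrc \<G> (a 0))
      else Inr (\<lambda>i\<in>{..<n - 1}.
        if Suc i < k then a i
        else if Suc i = k then gcomp \<G> (a i) (a (Suc i))
        else a (Suc i)))"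

text \<open>\<open>s\<^sub>k\<close> inserts a unit arrow at the \<open>k\<close>-th vertex, i.e. between \<open>a (k - 1)\<close> and \<open>a k\<close>.\<close>

definition nerve_degen ::
    "('o, 'a) lie_groupoid \<Rightarrow> nat \<Rightarrow> nat \<Rightarrow> ('o, 'a) nerve_simplex \<Rightarrow> ('o, 'a) nerve_simplex" where
  "nerve_degen \<G> n k z =
     (if n = 0 then Inr (\<lambda>i\<in>{..<1}. gunit \<G> (projl z))
      else let a = projr z in
        Inr (\<lambda>i\<in>{..<Suc n}.
          if i < k then a i
          else if i = k then gunit \<G> (if k < n then gsrc \<G> (a k) else gtgt \<G> (a (n - 1)))
          else a (i - 1)))"

definition nerve :: "('o, 'a) lie_groupoid \<Rightarrow> ('o, 'a) nerve_simplex simplicial_space" where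
  "nerve \<G> = \<lparr>level = nerve_level \<G>, sface = nerve_face \<G>, sdegen = nerve_degen \<G>\<rparr>"

text \<open>The simplicial map induced by a functor with object part \<open>f\<close> and arrow part \<open>h\<close>.\<close>

definition nerve_map ::
    "('o \<Rightarrow> 'p) \<Rightarrow> ('a \<Rightarrow> 'b) \<Rightarrow> nat \<Rightarrow> ('o, 'a) nerve_simplex \<Rightarrow> ('p, 'b) nerve_simplex" where
  "nerve_map f h n = map_sum f (\<lambda>a. \<lambda>i\<in>{..<n}. h (a i))"

definition classifying_space ::
    "('o, 'a) lie_groupoid \<Rightarrow> (nat \<times> (nat \<Rightarrow> real) \<times> ('o, 'a) nerve_simplex) set topology" where
  "classifying_space \<G> = geometric_realisation (nerve \<G>)"


section \<open>Action groupoids and the Borel construction\<close>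

definition action_groupoid ::
    "'g smooth_group \<Rightarrow> 'm manifold \<Rightarrow> ('g \<Rightarrow> 'm \<Rightarrow> 'm) \<Rightarrow> ('m, 'g \<times> 'm) lie_groupoid" where
  "action_groupoid G M \<phi> =
     \<lparr>gobj = M, garr = prod_manifold (gman G) M,
      gsrc = (\<lambda>(g, x). x), gtgt = (\<lambda>(g, x). \<phi> g x),
      gcomp = (\<lambda>(g\<^sub>1, x\<^sub>1) (g\<^sub>2, x\<^sub>2). (g\<^sub>2 \<otimes>\<^bsub>G\<^esub> g\<^sub>1, x\<^sub>1)),
      gunit = (\<lambda>x. (\<one>\<^bsub>G\<^esub>, x))\<rparr>"

definition pair_groupoid :: "'o manifold \<Rightarrow> ('o, 'o \<times> 'o) lie_groupoid" where
  "pair_groupoid M =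
     \<lparr>gobj = M, garr = prod_manifold M M, gsrc = fst, gtgt = snd,
      gcomp = (\<lambda>(x, y) (y', z). (x, z)), gunit = (\<lambda>x. (x, x))\<rparr>"

type_synonym 'g EG_point = "(nat \<times> (nat \<Rightarrow> real) \<times> ('g, 'g \<times> 'g) nerve_simplex) set"

definition EG :: "'g smooth_group \<Rightarrow> 'g EG_point topology" where
  "EG G = classifying_space (pair_groupoid (gman G))"

text \<open>The left action of \<open>G\<close> on \<open>EG\<close> induced by \<open>g \<cdot> g\<^sub>1 = g\<^sub>1 g\<^sup>-\<^sup>1\<close> on objects.\<close>

definition EG_action :: "'g smooth_group \<Rightarrow> 'g \<Rightarrow> 'g EG_point \<Rightarrow> 'g EG_point" where
  "EG_action G g =
     (let r = (\<lambda>h. h \<otimes>\<^bsub>G\<^esub> inv\<^bsub>G\<^esub> g)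
      in realisation_map (nerve (pair_groupoid (gman G))) (nerve_map r (map_prod r r)))"

definition borel_construction ::
    "'g smooth_group \<Rightarrow> 'm manifold \<Rightarrow> ('g \<Rightarrow> 'm \<Rightarrow> 'm) \<Rightarrow> ('g EG_point \<times> 'm) set topology" where
  "borel_construction G M \<phi> =
     quotient_topology (prod_topology (EG G) (mtop M))
       (orbit G (\<lambda>g. map_prod (EG_action G g) (\<phi> g)))"

end

theory Submission
  imports Defs
begin

text \<open>
  The two spaces are even homeomorphic. Write \<open>X\<close> for the nerve of the pair groupoid of \<open>G\<close> and \<open>Y\<close>
  for the nerve of the action groupoid. For every point \<open>x\<close> of \<open>M\<close> the functor \<open>g \<mapsto> g x\<close>,
  \<open>(g, h) \<mapsto> (h g\<^sup>-\<^sup>1, g x)\<close> induces a simplicial map from \<open>X\<close> to \<open>Y\<close>. Together these give maps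
  \<open>X\<^sub>n \<times> M \<rightarrow> Y\<^sub>n\<close> whose fibres are exactly the \<open>G\<close>-orbits and which have continuous sections (lift a
  string so that its first vertex is the unit of \<open>G\<close>). Hence the classifying space is a quotient of
  \<open>\<Coprod> \<Delta>\<^sup>n \<times> X\<^sub>n \<times> M\<close>. So is the Borel construction, because taking the product with the locally
  compact Hausdorff space \<open>M\<close> preserves quotient maps. Both quotients identify the same points.
\<close>

section \<open>Sums, quotients and manifolds\<close>

lemma continuous_map_fst_app:
  "continuous_map Z (prod_topology X Y) f \<Longrightarrow> continuous_map Z X (\<lambda>z. fst (f z))"
  using continuous_map_fst_of by (fastforce simp: comp_def)

lemma continuous_map_snd_app:
  "continuous_map Z (prod_topology X Y) f \<Longrightarrow> continuous_map Z Y (\<lambda>z. snd (f z))"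
  using continuous_map_snd_of by (fastforce simp: comp_def)

lemma continuous_map_from_sum_topology:
  assumes "\<And>i. i \<in> I \<Longrightarrow> continuous_map (X i) Z (\<lambda>x. f (i, x))"
  shows "continuous_map (sum_topology X I) Z f"
  unfolding continuous_map_def
proof (intro conjI allI impI)
  show "f \<in> topspace (sum_topology X I) \<rightarrow> topspace Z"
    using assms by (fastforce simp: continuous_map_def)
  fix U assume U: "openin Z U"
  have "openin (X i) {x. (i, x) \<in> {y \<in> topspace (sum_topology X I). f y \<in> U}}" if "i \<in> I" for i
  proof -
    have "{x. (i, x) \<in> {y \<in> topspace (sum_topology X I). f y \<in> U}} = {x \<in> topspace (X i). f (i, x) \<in> U}"
      using that by auto
    then show ?thesis
      using openin_continuous_map_preimage[OF assms[OF that] U] by simp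
  qed
  then show "openin (sum_topology X I) {y \<in> topspace (sum_topology X I). f y \<in> U}"
    unfolding openin_sum_topology by auto
qed

text \<open>Products distribute over disjoint sums: every summand \<open>X i\<close> is open in the
  sum, so the preimage of an open set is a union of open pieces, one for each summand.\<close>

lemma continuous_map_from_prod_sum_topology:
  assumes "\<And>i. i \<in> I \<Longrightarrow> continuous_map (prod_topology (X i) T) Z (\<lambda>(x, t). f ((i, x), t))"
  shows "continuous_map (prod_topology (sum_topology X I) T) Z f"
  unfolding continuous_map_def
proof (intro conjI allI impI)
  show "f \<in> topspace (prod_topology (sum_topology X I) T) \<rightarrow> topspace Z"
  proof clarsimp
    fix i x t assume "i \<in> I" "x \<in> topspace (X i)" "t \<in> topspace T"
    then show "f ((i, x), t) \<in> topspace Z"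
      using funcset_mem[OF continuous_map_funspace[OF assms], of i "(x, t)"] by simp
  qed
  fix U assume U: "openin Z U"
  let ?V = "\<lambda>i. {y \<in> topspace (prod_topology (X i) T). (\<lambda>(x, t). f ((i, x), t)) y \<in> U}"
  have "openin (prod_topology (sum_topology X I) T) (map_prod (Pair i) id ` ?V i)" if i: "i \<in> I" for i
  proof -
    have V: "openin (prod_topology (X i) T) (?V i)"
      using openin_continuous_map_preimage[OF assms[OF i] U] by simp
    show ?thesis
      unfolding openin_prod_topology_alt
    proof (intro allI impI)
      fix a t assume "(a, t) \<in> map_prod (Pair i) id ` ?V i"
      then obtain x where x: "a = (i, x)" "(x, t) \<in> ?V i" by auto
      then obtain A B where AB: "openin (X i) A" "openin T B" "x \<in> A" "t \<in> B" "A \<times> B \<subseteq> ?V i"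
        using V unfolding openin_prod_topology_alt by meson
      have "openin (sum_topology X I) (Pair i ` A)"
        using open_map_component_injection[OF i] AB(1) by (auto simp: open_map_def)
      moreover have "a \<in> Pair i ` A" "Pair i ` A \<times> B \<subseteq> map_prod (Pair i) id ` ?V i"
        using AB x(1) by force+
      ultimately show "\<exists>A B. openin (sum_topology X I) A \<and> openin T B \<and> a \<in> A \<and> t \<in> B \<and>
          A \<times> B \<subseteq> map_prod (Pair i) id ` ?V i"
        using AB by blast
    qed
  qed
  then have "openin (prod_topology (sum_topology X I) T) (\<Union>i\<in>I. map_prod (Pair i) id ` ?V i)"
    by blast
  moreover have "(\<Union>i\<in>I. map_prod (Pair i) id ` ?V i) =
      {y \<in> topspace (prod_topology (sum_topology X I) T). f y \<in> U}"
    by force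
  ultimately show "openin (prod_topology (sum_topology X I) T)
      {y \<in> topspace (prod_topology (sum_topology X I) T). f y \<in> U}"
    by simp
qed

text \<open>By the universal property each map factors through the other, and the two factors are
  mutually inverse because both quotient maps are surjective.\<close>

lemma quotient_maps_same_fibres_imp_homeomorphic_space:
  assumes f: "quotient_map X Y f" and g: "quotient_map X Z g"
    and fg: "\<And>x y. x \<in> topspace X \<Longrightarrow> y \<in> topspace X \<Longrightarrow> f x = f y \<longleftrightarrow> g x = g y"
  shows "Y homeomorphic_space Z"
proof -
  obtain h where h: "continuous_map Y Z h" "\<And>x. x \<in> topspace X \<Longrightarrow> h (f x) = g x"
    using quotient_map_lift_exists[OF f quotient_imp_continuous_map[OF g]] fg by metis
  obtain k where k: "continuous_map Z Y k" "\<And>x. x \<in> topspace X \<Longrightarrow> k (g x) = f x"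
    using quotient_map_lift_exists[OF g quotient_imp_continuous_map[OF f]] fg by metis
  have "\<forall>y \<in> topspace Y. k (h y) = y" "\<forall>z \<in> topspace Z. h (k z) = z"
    using h k quotient_imp_surjective_map[OF f] quotient_imp_surjective_map[OF g]
    by (metis (no_types, lifting) imageE)+
  then show ?thesis
    using h k unfolding homeomorphic_space_def homeomorphic_maps_def by blast
qed

text \<open>Charts transport local compactness from open subsets of Euclidean space. Chart domains
  are open, so neighbourhoods found inside one are neighbourhoods in the manifold.\<close>

lemma (in smooth_manifold) locally_compact: "locally_compact_space (mtop M)"
  unfolding locally_compact_space_def
proof
  fix x assume "x \<in> topspace (mtop M)"
  then have "x \<in> (\<Union>(U, c)\<in>atlas M. U)"
    by (simp add: covering)
  then obtain U c where U: "(U, c) \<in> atlas M" "x \<in> U"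
    by blast
  have chart: "openin (mtop M) U" "openin (Euclidean_space (mdim M)) (c ` U)"
    "homeomorphic_map (subtopology (mtop M) U) (subtopology (Euclidean_space (mdim M)) (c ` U)) c"
    using charts[OF U(1)] by (auto simp: is_chart_def)
  have "locally_compact_space (subtopology (Euclidean_space (mdim M)) (c ` U))"
    using chart(2) locally_compact_space_open_subset Hausdorff_Euclidean_space
      locally_compact_Euclidean_space by blast
  then have "locally_compact_space (subtopology (mtop M) U)"
    using chart(3) homeomorphic_locally_compact_space homeomorphic_map_imp_homeomorphic_space by blast
  moreover have "x \<in> topspace (subtopology (mtop M) U)"
    using U(2) chart(1) openin_subset by auto
  ultimately obtain V K where "openin (subtopology (mtop M) U) V" "compactin (subtopology (mtop M) U) K"
      "x \<in> V" "V \<subseteq> K"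
    unfolding locally_compact_space_def by blast
  then show "\<exists>V K. openin (mtop M) V \<and> compactin (mtop M) K \<and> x \<in> V \<and> V \<subseteq> K"
    using openin_trans_full[OF _ chart(1)] by (metis compactin_subtopology)
qed

section \<open>Simplicial maps and Borel constructions\<close>

definition simplicial_map :: "'a simplicial_space \<Rightarrow> 'b simplicial_space \<Rightarrow> (nat \<Rightarrow> 'a \<Rightarrow> 'b) \<Rightarrow> bool" where
  "simplicial_map X Y f \<longleftrightarrow>
     (\<forall>n. \<forall>x \<in> topspace (level X n). f n x \<in> topspace (level Y n)) \<and>
     (\<forall>n. \<forall>x \<in> topspace (level X (Suc n)). \<forall>k \<le> Suc n.
        f n (sface X (Suc n) k x) = sface Y (Suc n) k (f (Suc n) x)) \<and>
     (\<forall>n. \<forall>x \<in> topspace (level X n). \<forall>k \<le> n.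
        f (Suc n) (sdegen X n k x) = sdegen Y n k (f n x))"

lemma realisation_rel_simplicial_map:
  assumes "simplicial_map X Y f" "realisation_rel X (n, p, x) (n', p', x')"
  shows "realisation_rel Y (n, p, f n x) (n', p', f n' x')"
  using assms(2)
proof cases
  case (face k)
  then show ?thesis
    using assms(1) realisation_rel.face[of p' n' "f n x" Y k] by (simp add: simplicial_map_def)
next
  case (degen k)
  then show ?thesis
    using assms(1) realisation_rel.degen[of p' n "f n x" Y k] by (simp add: simplicial_map_def)
qed

lemma equivclp_realisation_rel_simplicial_map:
  assumes "simplicial_map X Y f" "equivclp (realisation_rel X) (n, p, x) (n', p', x')"
  shows "equivclp (realisation_rel Y) (n, p, f n x) (n', p', f n' x')"
proof -
  \<comment> \<open>The end point is generalised to a single variable \<open>w\<close>, so that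
    induction along the chain of identifications applies.\<close>
  have "equivclp (realisation_rel Y) (n, p, f n x) (case w of (n', p', x') \<Rightarrow> (n', p', f n' x'))"
    if "equivclp (realisation_rel X) (n, p, x) w" for w
    using that
  proof induction
    case (step y z)
    obtain n1 p1 x1 n2 p2 x2 where [simp]: "y = (n1, p1, x1)" "z = (n2, p2, x2)"
      by (metis prod_cases3)
    show ?case
      using step realisation_rel_simplicial_map[OF assms(1)]
      by (auto intro: equivclp_into_equivclp)
  qed simp
  from this[OF assms(2)] show ?thesis by simp
qed

lemma realisation_class_eq_iff:
  "realisation_class X z = realisation_class X w \<longleftrightarrow> equivclp (realisation_rel X) z w"
  unfolding realisation_class_def
  by (auto intro: equivclp_sym equivclp_trans)

text \<open>All representatives contribute the same class to the union that defines
  \<open>realisation_map\<close>, and there is at least one, so the union collapses.\<close>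

lemma realisation_map_realisation_class:
  assumes "simplicial_map X Y f"
  shows "realisation_map Y f (realisation_class X (n, p, x)) = realisation_class Y (n, p, f n x)"
proof -
  let ?c = "realisation_class X (n, p, x)"
  have *: "(case w of (n', p', x') \<Rightarrow> realisation_class Y (n', p', f n' x')) = realisation_class Y (n, p, f n x)"
    if "w \<in> ?c" for w
  proof -
    obtain n' p' x' where w: "w = (n', p', x')"
      by (metis prod_cases3)
    then have "equivclp (realisation_rel X) (n', p', x') (n, p, x)"
      using that by (simp add: realisation_class_def equivclp_sym)
    then show ?thesis
      using equivclp_realisation_rel_simplicial_map[OF assms] by (simp add: w realisation_class_eq_iff)
  qed
  have "realisation_map Y f ?c = (\<Union>w \<in> ?c. realisation_class Y (n, p, f n x))"
    unfolding realisation_map_def by (rule SUP_cong[OF refl *])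
  moreover have "(n, p, x) \<in> ?c"
    by (simp add: realisation_class_def)
  ultimately show ?thesis
    by auto
qed

text \<open>The abstract situation: \<open>Q n\<close> exhibits level \<open>n\<close> of
  \<open>Y\<close> as the orbit space of the diagonal action on level \<open>n\<close> of
  \<open>X\<close> times \<open>T\<close>, with a continuous section \<open>sec n\<close>.
  Compatibility with faces and degeneracies is asked of \<open>Q\<close> for each fixed point of
  \<open>T\<close>, continuity jointly in both arguments; \<open>sec\<close> is only a section level
  by level.\<close>

locale simplicial_quotient = group_action G "topspace T" \<phi>
  for G (structure) and T :: "'m topology" and \<phi> +
  fixes X :: "'a simplicial_space" and Y :: "'b simplicial_space"
    and act :: "'g \<Rightarrow> nat \<Rightarrow> 'a \<Rightarrow> 'a"
    and Q :: "nat \<Rightarrow> 'a \<Rightarrow> 'm \<Rightarrow> 'b" and sec :: "nat \<Rightarrow> 'b \<Rightarrow> 'a \<times> 'm"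
  assumes locally_compact: "locally_compact_space T" and Hausdorff: "Hausdorff_space T"
    and face_closed: "\<And>n k z. z \<in> topspace (level X (Suc n)) \<Longrightarrow> k \<le> Suc n \<Longrightarrow>
      sface X (Suc n) k z \<in> topspace (level X n)"
    and degen_closed: "\<And>n k z. z \<in> topspace (level X n) \<Longrightarrow> k \<le> n \<Longrightarrow>
      sdegen X n k z \<in> topspace (level X (Suc n))"
    and act_simplicial: "\<And>g. g \<in> carrier G \<Longrightarrow> simplicial_map X X (act g)"
    and act_one: "\<And>n z. z \<in> topspace (level X n) \<Longrightarrow> act \<one> n z = z"
    and act_mult: "\<And>g h n z. g \<in> carrier G \<Longrightarrow> h \<in> carrier G \<Longrightarrow> z \<in> topspace (level X n) \<Longrightarrow>
      act (g \<otimes> h) n z = act g n (act h n z)"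
    and Q_simplicial: "\<And>x. x \<in> topspace T \<Longrightarrow> simplicial_map X Y (\<lambda>n z. Q n z x)"
    and Q_continuous: "\<And>n. continuous_map (prod_topology (level X n) T) (level Y n) (\<lambda>(z, x). Q n z x)"
    and sec_continuous: "\<And>n. continuous_map (level Y n) (prod_topology (level X n) T) (sec n)"
    and Q_sec: "\<And>n y. y \<in> topspace (level Y n) \<Longrightarrow> (\<lambda>(z, x). Q n z x) (sec n y) = y"
    and Q_invariant: "\<And>n g z x. g \<in> carrier G \<Longrightarrow> z \<in> topspace (level X n) \<Longrightarrow> x \<in> topspace T \<Longrightarrow>
      Q n (act g n z) (\<phi> g x) = Q n z x"
    and Q_fibre: "\<And>n z x z' x'. z \<in> topspace (level X n) \<Longrightarrow> x \<in> topspace T \<Longrightarrow>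
      z' \<in> topspace (level X n) \<Longrightarrow> x' \<in> topspace T \<Longrightarrow> Q n z x = Q n z' x' \<Longrightarrow>
      \<exists>g \<in> carrier G. z' = act g n z \<and> x' = \<phi> g x"
begin

section \<open>Diagonal orbits in terms of representatives\<close>

sublocale group G
  using group_hom group_hom.axioms(1) by blast

abbreviation "Borel_orbit \<equiv> orbit G (\<lambda>g. map_prod (realisation_map X (act g)) (\<phi> g))"

lemma Borel_orbit_class:
  "Borel_orbit (realisation_class X (n, p, z), x) =
     {(realisation_class X (n, p, act g n z), \<phi> g x) | g. g \<in> carrier G}"
  unfolding orbit_def Setcompr_eq_image
  by (rule image_cong) (simp_all add: realisation_map_realisation_class[OF act_simplicial])

lemma act_closed:
  "g \<in> carrier G \<Longrightarrow> z \<in> topspace (level X n) \<Longrightarrow> act g n z \<in> topspace (level X n)"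
  using act_simplicial by (simp add: simplicial_map_def)

text \<open>Acting by \<open>g\<close> first merely reindexes the orbit by the right translation
  \<open>h \<otimes> g\<close>, which maps \<open>carrier G\<close> onto itself.\<close>

lemma Borel_orbit_act:
  assumes g: "g \<in> carrier G" and z: "z \<in> topspace (level X n)" and x: "x \<in> topspace T"
  shows "Borel_orbit (realisation_class X (n, p, act g n z), \<phi> g x) =
    Borel_orbit (realisation_class X (n, p, z), x)"
proof -
  have eq: "(realisation_class X (n, p, act h n (act g n z)), \<phi> h (\<phi> g x)) =
      (realisation_class X (n, p, act (h \<otimes> g) n z), \<phi> (h \<otimes> g) x)" if "h \<in> carrier G" for h
    using that assms by (simp add: act_mult composition_rule)
  have "h \<in> (\<lambda>h. h \<otimes> g) ` carrier G" if "h \<in> carrier G" for h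
    by (rule image_eqI[of _ _ "h \<otimes> inv g"]) (use that g in \<open>simp_all add: m_assoc\<close>)
  then have "(\<lambda>h. h \<otimes> g) ` carrier G = carrier G"
    using g by auto
  then have "(\<lambda>h. F (h \<otimes> g)) ` carrier G = F ` carrier G" for F :: "_ \<Rightarrow> 'z"
    by (metis image_image)
  then show ?thesis
    unfolding Borel_orbit_class Setcompr_eq_image using eq by (simp cong: image_cong_simp)
qed

text \<open>The second point lies in its own orbit, through the unit, and hence in the orbit of the
  first.\<close>

lemma Borel_orbit_eqE:
  assumes "Borel_orbit (realisation_class X (n, p, z), x) = Borel_orbit (realisation_class X (n', p', z'), x')"
    and "z' \<in> topspace (level X n')" "x' \<in> topspace T"
  obtains g where "g \<in> carrier G" "x' = \<phi> g x"
    "equivclp (realisation_rel X) (n, p, act g n z) (n', p', z')"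
proof -
  have "\<phi> \<one> x' = x'"
    using id_eq_one assms(3) by (metis restrict_apply')
  then have "(realisation_class X (n', p', z'), x') \<in> Borel_orbit (realisation_class X (n', p', z'), x')"
    unfolding Borel_orbit_class using act_one[OF assms(2)] by force
  then have "(realisation_class X (n', p', z'), x') \<in> Borel_orbit (realisation_class X (n, p, z), x)"
    using assms(1) by simp
  then obtain g where "g \<in> carrier G" "x' = \<phi> g x"
      "realisation_class X (n', p', z') = realisation_class X (n, p, act g n z)"
    unfolding Borel_orbit_class by blast
  then show thesis
    using that by (simp add: realisation_class_eq_iff equivclp_sym)
qed

text \<open>
  This map is constant on the classes of \<open>Y\<close>: it inverts the map \<open>Q\<close> induces from the Borel construction.
\<close>

definition lift_orbit :: "nat \<times> (nat \<Rightarrow> real) \<times> 'b \<Rightarrow> ((nat \<times> (nat \<Rightarrow> real) \<times> 'a) set \<times> 'm) set" where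
  "lift_orbit = (\<lambda>(n, p, y). Borel_orbit (realisation_class X (n, p, fst (sec n y)), snd (sec n y)))"

lemma sec_mem:
  assumes "y \<in> topspace (level Y n)"
  shows "fst (sec n y) \<in> topspace (level X n)" "snd (sec n y) \<in> topspace T"
  using continuous_map_image_subset_topspace[OF sec_continuous[of n]] assms by force+

text \<open>The chosen lift of \<open>Q n z x\<close> and the pair of \<open>z\<close> and
  \<open>x\<close> lie in one fibre of \<open>Q\<close>, so by \<open>Q_fibre\<close> they differ by
  a group element. Hence \<open>lift_orbit\<close> may be computed from any lift.\<close>

lemma lift_orbit_Q:
  assumes z: "z \<in> topspace (level X n)" and x: "x \<in> topspace T"
  shows "lift_orbit (n, p, Q n z x) = Borel_orbit (realisation_class X (n, p, z), x)"
proof -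
  have y: "Q n z x \<in> topspace (level Y n)"
    using Q_simplicial[OF x] z by (simp add: simplicial_map_def)
  have "Q n (fst (sec n (Q n z x))) (snd (sec n (Q n z x))) = Q n z x"
    using Q_sec[OF y] by (simp add: case_prod_beta)
  then obtain g where "g \<in> carrier G" "fst (sec n (Q n z x)) = act g n z" "snd (sec n (Q n z x)) = \<phi> g x"
    using Q_fibre[OF z x sec_mem[OF y]] by metis
  then show ?thesis
    using Borel_orbit_act[OF _ z x] by (simp add: lift_orbit_def)
qed

text \<open>A face or degeneracy of the chosen lift is a lift of the face or degeneracy of
  \<open>y\<close>, though perhaps not the chosen one; \<open>lift_orbit_Q\<close> makes this
  difference harmless. The identification in \<open>Y\<close> thus becomes one in \<open>X\<close>
  over a fixed point \<open>x\<close>.\<close>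

lemma lift_orbit_realisation_rel:
  assumes "realisation_rel Y u v"
  shows "lift_orbit u = lift_orbit v"
  using assms
proof cases
  case (face p n y k)
  define z x where "z = fst (sec (Suc n) y)" and "x = snd (sec (Suc n) y)"
  have z: "z \<in> topspace (level X (Suc n))" and x: "x \<in> topspace T"
    using sec_mem face by (auto simp: z_def x_def)
  have y: "y = Q (Suc n) z x"
    using Q_sec face by (simp add: z_def x_def case_prod_beta)
  have "sface Y (Suc n) k y = Q n (sface X (Suc n) k z) x"
    using Q_simplicial[OF x] z face by (simp add: simplicial_map_def y)
  moreover have "equivclp (realisation_rel X) (Suc n, simplical_face k p, z) (n, p, sface X (Suc n) k z)"
    using face z by (auto intro: realisation_rel.face)
  ultimately show ?thesis
    using face z x face_closed
    by (simp add: lift_orbit_Q y realisation_class_eq_iff[THEN iffD2])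
next
  case (degen p n y k)
  define z x where "z = fst (sec n y)" and "x = snd (sec n y)"
  have z: "z \<in> topspace (level X n)" and x: "x \<in> topspace T"
    using sec_mem degen by (auto simp: z_def x_def)
  have y: "y = Q n z x"
    using Q_sec degen by (simp add: z_def x_def case_prod_beta)
  have "sdegen Y n k y = Q (Suc n) (sdegen X n k z) x"
    using Q_simplicial[OF x] z degen by (simp add: simplicial_map_def y)
  moreover have "equivclp (realisation_rel X) (n, simplicial_degen k p, z) (Suc n, p, sdegen X n k z)"
    using degen z by (auto intro: realisation_rel.degen)
  ultimately show ?thesis
    using degen z x degen_closed
    by (simp add: lift_orbit_Q y realisation_class_eq_iff[THEN iffD2])
qed

text \<open>From left to right, \<open>lift_orbit\<close> is constant along the identifications of
  \<open>Y\<close>. From right to left, a chain of identifications in \<open>X\<close> is pushed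
  forward by \<open>Q\<close>.\<close>

lemma same_fibres:
  assumes "z \<in> topspace (level X n)" "x \<in> topspace T" "z' \<in> topspace (level X n')" "x' \<in> topspace T"
  shows "realisation_class Y (n, p, Q n z x) = realisation_class Y (n', p', Q n' z' x') \<longleftrightarrow>
    Borel_orbit (realisation_class X (n, p, z), x) = Borel_orbit (realisation_class X (n', p', z'), x')"
    (is "?L \<longleftrightarrow> ?R")
proof
  have *: "lift_orbit u = lift_orbit v" if "equivclp (realisation_rel Y) u v" for u v
    using that by induction (auto dest: lift_orbit_realisation_rel)
  show "?L \<Longrightarrow> ?R"
    using * assms by (fastforce simp: realisation_class_eq_iff lift_orbit_Q)
next
  assume ?R
  then obtain g where g: "g \<in> carrier G" "x' = \<phi> g x"
      "equivclp (realisation_rel X) (n, p, act g n z) (n', p', z')"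
    by (rule Borel_orbit_eqE[OF _ assms(3,4)])
  \<comment> \<open>After acting by \<open>g\<close> both representatives lie over
    \<open>x'\<close>, so a single simplicial map, that of \<open>x'\<close>, carries the whole
    chain to \<open>Y\<close>.\<close>
  have "equivclp (realisation_rel Y) (n, p, Q n (act g n z) x') (n', p', Q n' z' x')"
    using equivclp_realisation_rel_simplicial_map[OF Q_simplicial[OF assms(4)] g(3)] by simp
  then show ?L
    using Q_invariant g assms by (simp add: realisation_class_eq_iff)
qed

text \<open>The levelwise sections assemble to a continuous section \<open>S\<close>, and a
  continuous map with a continuous section is a quotient map.\<close>

lemma quotient_map_total_space:
  "quotient_map (prod_topology (total_space X) T) (total_space Y) (\<lambda>((n, p, z), x). (n, p, Q n z x))"
    (is "quotient_map ?P _ ?F")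
proof -
  define S where "S = (\<lambda>(n, p, y). ((n, p, fst (sec n y)), snd (sec n y)) :: (nat \<times> (nat \<Rightarrow> real) \<times> 'a) \<times> 'm)"
  have "continuous_map ?P (total_space Y) ?F"
    unfolding total_space_def
  proof (rule continuous_map_from_prod_sum_topology)
    fix n
    let ?D = "prod_topology (prod_topology (simplex_space n) (level X n)) T"
    have "continuous_map ?D (level Y n) ((\<lambda>(z, x). Q n z x) \<circ> (\<lambda>w. (snd (fst w), snd w)))"
      by (rule continuous_map_compose[OF _ Q_continuous])
        (intro continuous_map_pairedI continuous_map_snd continuous_map_snd_app[OF continuous_map_fst])
    then have "continuous_map ?D (prod_topology (simplex_space n) (level Y n))
        (\<lambda>w. (fst (fst w), Q n (snd (fst w)) (snd w)))"
      by (intro continuous_map_pairedI continuous_map_fst_app[OF continuous_map_fst]) (simp add: comp_def)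
    then have "continuous_map ?D (sum_topology (\<lambda>n. prod_topology (simplex_space n) (level Y n)) UNIV)
        (Pair n \<circ> (\<lambda>w. (fst (fst w), Q n (snd (fst w)) (snd w))))"
      by (rule continuous_map_compose)
        (rule continuous_map_component_injection[of n UNIV "\<lambda>n. prod_topology (simplex_space n) (level Y n)", OF UNIV_I])
    moreover have "Pair n \<circ> (\<lambda>w. (fst (fst w), Q n (snd (fst w)) (snd w))) = (\<lambda>(w, x). ?F ((n, w), x))"
      by auto
    ultimately show "continuous_map ?D (sum_topology (\<lambda>n. prod_topology (simplex_space n) (level Y n)) UNIV)
        (\<lambda>(w, x). ?F ((n, w), x))"
      by simp
  qed
  moreover have "continuous_map (total_space Y) ?P S"
    unfolding total_space_def
  proof (rule continuous_map_from_sum_topology)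
    fix n
    let ?D = "prod_topology (simplex_space n) (level Y n)"
    have s: "continuous_map ?D (prod_topology (level X n) T) (sec n \<circ> snd)"
      by (rule continuous_map_compose[OF _ sec_continuous], intro continuous_intros)
    have s1: "continuous_map ?D (level X n) (\<lambda>w. fst (sec n (snd w)))"
      and s2: "continuous_map ?D T (\<lambda>w. snd (sec n (snd w)))"
      using continuous_map_compose[OF s continuous_map_fst] continuous_map_compose[OF s continuous_map_snd]
      by (simp_all add: comp_def)
    have "continuous_map ?D (prod_topology (simplex_space n) (level X n)) (\<lambda>w. (fst w, fst (sec n (snd w))))"
      by (intro continuous_intros s1)
    then have "continuous_map ?D (sum_topology (\<lambda>n. prod_topology (simplex_space n) (level X n)) UNIV)
        (Pair n \<circ> (\<lambda>w. (fst w, fst (sec n (snd w)))))"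
      by (rule continuous_map_compose)
        (rule continuous_map_component_injection[of n UNIV "\<lambda>n. prod_topology (simplex_space n) (level X n)", OF UNIV_I])
    then show "continuous_map ?D
        (prod_topology (sum_topology (\<lambda>n. prod_topology (simplex_space n) (level X n)) UNIV) T)
        (\<lambda>w. S (n, w))"
      unfolding S_def case_prod_beta by (intro continuous_map_pairedI) (simp_all add: s2 comp_def)
  qed
  moreover have "?F (S w) = w" if "w \<in> topspace (total_space Y)" for w
    using that Q_sec by (auto simp: total_space_def S_def case_prod_beta)
  ultimately have "retraction_maps ?P (total_space Y) ?F S"
    by (simp add: retraction_maps_def)
  then show ?thesis
    by (meson retraction_imp_quotient_map retraction_map_def)
qed

theorem geometric_realisation_homeomorphic_Borel:
  "geometric_realisation Y homeomorphic_space
   quotient_topology (prod_topology (geometric_realisation X) T) Borel_orbit"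
proof (rule quotient_maps_same_fibres_imp_homeomorphic_space)
  let ?P = "prod_topology (total_space X) T"
  let ?f = "realisation_class Y \<circ> (\<lambda>((n, p, z), x). (n, p, Q n z x))"
  let ?g = "Borel_orbit \<circ> (\<lambda>(a, x). (realisation_class X a, x))"
  show "quotient_map ?P (geometric_realisation Y) ?f"
    unfolding geometric_realisation_def
    by (rule quotient_map_compose[OF quotient_map_total_space quotient_map_quotient_topology])
  \<comment> \<open>Local compactness and the Hausdorff property of \<open>T\<close> enter here: the
    product of a quotient map with the identity of \<open>T\<close> is again a quotient map.\<close>
  have "quotient_map ?P (prod_topology (geometric_realisation X) T) (\<lambda>(a, x). (realisation_class X a, x))"
    unfolding geometric_realisation_def
    by (simp add: Hausdorff locally_compact quotient_map_prod_left quotient_map_quotient_topology)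
  then show "quotient_map ?P (quotient_topology (prod_topology (geometric_realisation X) T) Borel_orbit) ?g"
    by (rule quotient_map_compose[OF _ quotient_map_quotient_topology])
  fix u v assume "u \<in> topspace ?P" "v \<in> topspace ?P"
  then show "?f u = ?f v \<longleftrightarrow> ?g u = ?g v"
    unfolding total_space_def by clarsimp (use same_fibres in blast)
qed

end

section \<open>Nerves of functors\<close>

lemma topspace_nerve_level_0: "topspace (nerve_level A 0) = Inl ` topspace (mtop (gobj A))"
  by (auto simp: nerve_level_def topspace_pullback_topology)

lemma topspace_nerve_level_Suc:
  "topspace (nerve_level A (Suc n)) =
     Inr ` {a \<in> {..<Suc n} \<rightarrow>\<^sub>E topspace (mtop (garr A)). \<forall>i<n. gtgt A (a i) = gsrc A (a (Suc i))}"
  by (auto simp: nerve_level_def composable_strings_def topspace_pullback_topology)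

lemma nerve_level_0E:
  assumes "z \<in> topspace (nerve_level A 0)"
  obtains x where "z = Inl x" "x \<in> topspace (mtop (gobj A))"
  using assms by (auto simp: topspace_nerve_level_0)

lemma nerve_level_SucE:
  assumes "z \<in> topspace (nerve_level A (Suc n))"
  obtains a where "z = Inr a" "a \<in> extensional {..<Suc n}"
    "\<And>i. i \<le> n \<Longrightarrow> a i \<in> topspace (mtop (garr A))"
    "\<And>i. i < n \<Longrightarrow> gtgt A (a i) = gsrc A (a (Suc i))"
  using assms by (auto simp: topspace_nerve_level_Suc PiE_iff)

lemma nerve_level_SucI:
  assumes "a \<in> extensional {..<Suc n}"
    and "\<And>i. i \<le> n \<Longrightarrow> a i \<in> topspace (mtop (garr A))"
    and "\<And>i. i < n \<Longrightarrow> gtgt A (a i) = gsrc A (a (Suc i))"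
  shows "Inr a \<in> topspace (nerve_level A (Suc n))"
  using assms by (auto simp: topspace_nerve_level_Suc PiE_iff)

lemma continuous_map_projl_nerve_level:
  "continuous_map (nerve_level A 0) (mtop (gobj A)) projl"
  using continuous_map_pullback[of "mtop (gobj A)" "mtop (gobj A)" id "range Inl" projl] by (simp add: nerve_level_def)

lemma continuous_map_projr_nerve_level:
  assumes "i < Suc n"
  shows "continuous_map (nerve_level A (Suc n)) (mtop (garr A)) (\<lambda>z. projr z i)"
proof -
  have "continuous_map (composable_strings A (Suc n)) (mtop (garr A)) (\<lambda>a. a i)"
    unfolding composable_strings_def using assms
    by (intro continuous_map_from_subtopology continuous_map_product_projection) simp
  from continuous_map_pullback[OF this, of "range Inr" projr] show ?thesis
    by (simp add: nerve_level_def comp_def)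
qed

lemma continuous_map_Inl_nerve_level:
  assumes "continuous_map Z (mtop (gobj A)) f"
  shows "continuous_map Z (nerve_level A 0) (\<lambda>z. Inl (f z))"
  using assms by (auto simp: nerve_level_def comp_def intro!: continuous_map_pullback')

lemma continuous_map_Inr_nerve_level:
  assumes "\<And>i. i \<le> n \<Longrightarrow> continuous_map Z (mtop (garr A)) (f i)"
    and "\<And>i z. i < n \<Longrightarrow> z \<in> topspace Z \<Longrightarrow> gtgt A (f i z) = gsrc A (f (Suc i) z)"
  shows "continuous_map Z (nerve_level A (Suc n)) (\<lambda>z. Inr (\<lambda>i\<in>{..<Suc n}. f i z))"
proof -
  have "continuous_map Z (composable_strings A (Suc n)) (\<lambda>z. \<lambda>i\<in>{..<Suc n}. f i z)"
    using assms by (auto simp: composable_strings_def continuous_map_in_subtopology continuous_map_componentwise)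
  then show ?thesis
    by (auto simp: nerve_level_def comp_def intro!: continuous_map_pullback')
qed

section \<open>Functors acting on nerves\<close>

lemma nerve_map_Inl [simp]: "nerve_map f h n (Inl x) = Inl (f x)"
  and nerve_map_Inr [simp]: "nerve_map f h n (Inr a) = Inr (\<lambda>i\<in>{..<n}. h (a i))"
  by (simp_all add: nerve_map_def)

text \<open>Agreement on points of the manifolds is the right condition, since group identities hold
  only on \<open>carrier G\<close>.\<close>

lemma nerve_map_eqI:
  assumes "z \<in> topspace (nerve_level A n)"
    and "\<And>x. x \<in> topspace (mtop (gobj A)) \<Longrightarrow> f x = f' x"
    and "\<And>a. a \<in> topspace (mtop (garr A)) \<Longrightarrow> h a = h' a"
  shows "nerve_map f h n z = nerve_map f' h' n z"
proof (cases n)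
  case 0
  then show ?thesis
    using assms by (auto elim!: nerve_level_0E)
next
  case (Suc m)
  then obtain a where "z = Inr a" "\<And>i. i \<le> m \<Longrightarrow> a i \<in> topspace (mtop (garr A))"
    using assms(1) nerve_level_SucE by metis
  then show ?thesis
    using assms(3) Suc by (auto simp: restrict_def fun_eq_iff)
qed

lemma nerve_map_ident:
  assumes "z \<in> topspace (nerve_level A n)"
  shows "nerve_map (\<lambda>x. x) (\<lambda>a. a) n z = z"
proof (cases n)
  case 0
  then show ?thesis
    using assms by (auto elim!: nerve_level_0E)
next
  case (Suc m)
  then obtain a where "z = Inr a" "a \<in> extensional {..<Suc m}"
    using assms nerve_level_SucE by metis
  then show ?thesis
    using Suc by (simp add: extensional_restrict)
qed

lemma nerve_map_nerve_map:
  "nerve_map f h n (nerve_map f' h' n z) = nerve_map (\<lambda>x. f (f' x)) (\<lambda>a. h (h' a)) n z"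
  by (cases z) (auto simp: restrict_def fun_eq_iff)

lemma nerve_map_closed:
  assumes "z \<in> topspace (nerve_level A n)"
    and "\<And>x. x \<in> topspace (mtop (gobj A)) \<Longrightarrow> f x \<in> topspace (mtop (gobj B))"
    and "\<And>a. a \<in> topspace (mtop (garr A)) \<Longrightarrow> h a \<in> topspace (mtop (garr B))"
    and "\<And>a. a \<in> topspace (mtop (garr A)) \<Longrightarrow> gsrc B (h a) = f (gsrc A a)"
    and "\<And>a. a \<in> topspace (mtop (garr A)) \<Longrightarrow> gtgt B (h a) = f (gtgt A a)"
  shows "nerve_map f h n z \<in> topspace (nerve_level B n)"
proof (cases n)
  case 0
  then show ?thesis
    using assms by (auto simp: topspace_nerve_level_0)
next
  case (Suc m)
  then obtain a where "z = Inr a" "\<And>i. i \<le> m \<Longrightarrow> a i \<in> topspace (mtop (garr A))"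
      "\<And>i. i < m \<Longrightarrow> gtgt A (a i) = gsrc A (a (Suc i))"
    using assms(1) by (auto elim!: nerve_level_SucE)
  then show ?thesis
    using assms(2-) Suc by (auto intro!: nerve_level_SucI)
qed

lemma nerve_map_nerve_face:
  assumes z: "z \<in> topspace (nerve_level A (Suc n))" and k: "k \<le> Suc n"
    and src: "\<And>a. a \<in> topspace (mtop (garr A)) \<Longrightarrow> gsrc B (h a) = f (gsrc A a)"
    and tgt: "\<And>a. a \<in> topspace (mtop (garr A)) \<Longrightarrow> gtgt B (h a) = f (gtgt A a)"
    and comp: "\<And>a b. a \<in> topspace (mtop (garr A)) \<Longrightarrow> b \<in> topspace (mtop (garr A)) \<Longrightarrow>
      gtgt A a = gsrc A b \<Longrightarrow> h (gcomp A a b) = gcomp B (h a) (h b)"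
  shows "nerve_map f h n (nerve_face A (Suc n) k z) = nerve_face B (Suc n) k (nerve_map f h (Suc n) z)"
proof -
  obtain a where z: "z = Inr a" and a: "\<And>i. i \<le> n \<Longrightarrow> a i \<in> topspace (mtop (garr A))"
      "\<And>i. i < n \<Longrightarrow> gtgt A (a i) = gsrc A (a (Suc i))"
    using z by (auto elim!: nerve_level_SucE)
  show ?thesis
  \<comment> \<open>Level 1 is separate, as its faces are source and target and land in the summand
    of objects. Above it, inner faces need the functor to respect composition.\<close>
  proof (cases "n = 0")
    case True
    then show ?thesis
      using a(1)[of 0] src tgt by (simp add: nerve_face_def z)
  next
    case False
    then show ?thesis
      using a comp by (auto simp: nerve_face_def z restrict_def fun_eq_iff)
  qed
qed

lemma nerve_map_nerve_degen:
  assumes z: "z \<in> topspace (nerve_level A n)" and k: "k \<le> n"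
    and obj: "\<And>a. a \<in> topspace (mtop (garr A)) \<Longrightarrow> gsrc A a \<in> topspace (mtop (gobj A))"
      "\<And>a. a \<in> topspace (mtop (garr A)) \<Longrightarrow> gtgt A a \<in> topspace (mtop (gobj A))"
    and src: "\<And>a. a \<in> topspace (mtop (garr A)) \<Longrightarrow> gsrc B (h a) = f (gsrc A a)"
    and tgt: "\<And>a. a \<in> topspace (mtop (garr A)) \<Longrightarrow> gtgt B (h a) = f (gtgt A a)"
    and unit: "\<And>x. x \<in> topspace (mtop (gobj A)) \<Longrightarrow> h (gunit A x) = gunit B (f x)"
  shows "nerve_map f h (Suc n) (nerve_degen A n k z) = nerve_degen B n k (nerve_map f h n z)"
proof (cases n)
  case 0
  then show ?thesis
    using z unit by (auto simp: nerve_degen_def restrict_def fun_eq_iff elim!: nerve_level_0E)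
next
  case (Suc m)
  then obtain a where z: "z = Inr a" and a: "\<And>i. i < n \<Longrightarrow> a i \<in> topspace (mtop (garr A))"
    using z by (auto elim!: nerve_level_SucE)
  \<comment> \<open>The inserted unit sits at a source if \<open>k < n\<close>, but at the target of
    the last arrow if \<open>k = n\<close>.\<close>
  have "h (gunit A (gsrc A (a i))) = gunit B (gsrc B (h (a i)))"
    "h (gunit A (gtgt A (a i))) = gunit B (gtgt B (h (a i)))" if "i < n" for i
    using a[OF that] src tgt unit obj by simp_all
  then show ?thesis
    using Suc k by (auto simp: nerve_degen_def z restrict_def fun_eq_iff)
qed

section \<open>The nerve of the pair groupoid\<close>

lemma pair_groupoid_simps [simp]:
  "topspace (mtop (gobj (pair_groupoid N))) = topspace (mtop N)"
  "topspace (mtop (garr (pair_groupoid N))) = topspace (mtop N) \<times> topspace (mtop N)"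
  "gsrc (pair_groupoid N) = fst" "gtgt (pair_groupoid N) = snd"
  "gunit (pair_groupoid N) x = (x, x)"
  "gcomp (pair_groupoid N) a b = (fst a, snd b)"
  by (simp_all add: pair_groupoid_def prod_manifold_def case_prod_beta)

text \<open>Composing two arrows keeps their outer vertices, so neighbouring arrows still
  match.\<close>

lemma nerve_face_pair_groupoid_closed:
  assumes z: "z \<in> topspace (nerve_level (pair_groupoid N) (Suc n))" and k: "k \<le> Suc n"
  shows "nerve_face (pair_groupoid N) (Suc n) k z \<in> topspace (nerve_level (pair_groupoid N) n)"
proof -
  obtain a where z: "z = Inr a" and a: "\<And>i. i \<le> n \<Longrightarrow> a i \<in> topspace (mtop N) \<times> topspace (mtop N)"
      "\<And>i. i < n \<Longrightarrow> snd (a i) = fst (a (Suc i))"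
    using z by (auto elim!: nerve_level_SucE)
  show ?thesis
  proof (cases n)
    case 0
    then show ?thesis
      using a(1)[of 0] by (auto simp: nerve_face_def z topspace_nerve_level_0)
  next
    case (Suc m)
    show ?thesis
      unfolding nerve_face_def z Suc Let_def
      using a by (auto simp: Suc mem_Times_iff intro!: nerve_level_SucI)
  qed
qed

lemma nerve_degen_pair_groupoid_closed:
  assumes z: "z \<in> topspace (nerve_level (pair_groupoid N) n)" and k: "k \<le> n"
  shows "nerve_degen (pair_groupoid N) n k z \<in> topspace (nerve_level (pair_groupoid N) (Suc n))"
proof (cases n)
  case 0
  then show ?thesis
    using z by (auto simp: nerve_degen_def intro!: nerve_level_SucI elim!: nerve_level_0E)
next
  case (Suc m)
  then obtain a where z: "z = Inr a" and a: "\<And>i. i \<le> m \<Longrightarrow> a i \<in> topspace (mtop N) \<times> topspace (mtop N)"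
      "\<And>i. i < m \<Longrightarrow> snd (a i) = fst (a (Suc i))"
    using z by (auto elim!: nerve_level_SucE)
  \<comment> \<open>Behind the inserted unit the new string reads \<open>a\<close> at
    \<open>i - 1\<close>, so the matching condition is needed in this shifted form.\<close>
  have a': "snd (a (i - 1)) = fst (a i)" if "0 < i" "i \<le> m" for i
    using a(2)[of "i - 1"] that by simp
  show ?thesis
    unfolding nerve_degen_def z Suc Let_def
    using a k a' by (auto simp: Suc mem_Times_iff less_Suc_eq intro!: nerve_level_SucI)
qed

section \<open>The action groupoid\<close>

locale lie_group_action = lie_group G + base: smooth_manifold M + smooth_action G M \<phi>
  for G :: "'g smooth_group" (structure) and M :: "'m manifold" and \<phi> :: "'g \<Rightarrow> 'm \<Rightarrow> 'm"
begin

abbreviation "\<E> \<equiv> pair_groupoid (gman G)"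
abbreviation "\<A> \<equiv> action_groupoid G M \<phi>"
abbreviation "G\<^sub>T \<equiv> mtop (gman G)"
abbreviation "M\<^sub>T \<equiv> mtop M"

text \<open>The action on \<open>EG\<close> before realisation: \<open>EG_action G g\<close> is the
  map it induces on classes.\<close>

definition EG_simplex_action :: "'g \<Rightarrow> nat \<Rightarrow> ('g, 'g \<times> 'g) nerve_simplex \<Rightarrow> ('g, 'g \<times> 'g) nerve_simplex" where
  "EG_simplex_action g = nerve_map (\<lambda>h. h \<otimes> inv g) (map_prod (\<lambda>h. h \<otimes> inv g) (\<lambda>h. h \<otimes> inv g))"

text \<open>An arrow from \<open>g\<close> to \<open>h\<close> has to go to one from
  \<open>\<phi> g x\<close> to \<open>\<phi> h x\<close>. The choice
  \<open>h \<otimes> inv g\<close> for its group part does not change under right translation of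
  \<open>g\<close> and \<open>h\<close>.\<close>

definition orbit_simplex :: "nat \<Rightarrow> ('g, 'g \<times> 'g) nerve_simplex \<Rightarrow> 'm \<Rightarrow> ('m, 'g \<times> 'm) nerve_simplex" where
  "orbit_simplex n z x = nerve_map (\<lambda>g. \<phi> g x) (\<lambda>(g, h). (h \<otimes> inv g, \<phi> g x)) n z"

primrec path_product :: "(nat \<Rightarrow> 'g \<times> 'm) \<Rightarrow> nat \<Rightarrow> 'g" where
  "path_product a 0 = \<one>"
| "path_product a (Suc i) = fst (a i) \<otimes> path_product a i"

text \<open>
  The vertices \<open>x\<^sub>0, \<dots>, x\<^sub>n\<close> of a string \<open>a\<close> are \<open>x\<^sub>i = p\<^sub>i x\<^sub>0\<close> for \<open>p\<^sub>i = path_product a i\<close>, so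
  \<open>p\<^sub>0 = \<one>, \<dots>, p\<^sub>n\<close> are the vertices of a lift over \<open>x\<^sub>0\<close>.
\<close>

definition lift_simplex :: "nat \<Rightarrow> ('m, 'g \<times> 'm) nerve_simplex \<Rightarrow> ('g, 'g \<times> 'g) nerve_simplex \<times> 'm" where
  "lift_simplex n y =
     (if n = 0 then (Inl \<one>, projl y)
      else (Inr (\<lambda>i\<in>{..<n}. (path_product (projr y) i, path_product (projr y) (Suc i))),
            snd (projr y 0)))"

lemma action_groupoid_simps [simp]:
  "gobj \<A> = M" "mtop (garr \<A>) = prod_topology G\<^sub>T M\<^sub>T"
  "gsrc \<A> a = snd a" "gtgt \<A> a = \<phi> (fst a) (snd a)"
  "gunit \<A> x = (\<one>, x)" "gcomp \<A> a b = (fst b \<otimes> fst a, snd a)"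
  by (simp_all add: action_groupoid_def prod_manifold_def case_prod_beta)

lemma pair_groupoid_mtop [simp]: "gobj \<E> = gman G" "mtop (garr \<E>) = prod_topology G\<^sub>T G\<^sub>T"
  by (simp_all add: pair_groupoid_def prod_manifold_def)

lemma action_closed: "g \<in> carrier G \<Longrightarrow> x \<in> topspace M\<^sub>T \<Longrightarrow> \<phi> g x \<in> topspace M\<^sub>T"
  using element_image by blast

lemma action_one: "x \<in> topspace M\<^sub>T \<Longrightarrow> \<phi> \<one> x = x"
  using id_eq_one by (metis restrict_apply')

text \<open>This gives the target of the image of an arrow from \<open>g\<close> to \<open>h\<close>
  under the orbit functor.\<close>

lemma action_shift:
  assumes "g \<in> carrier G" "h \<in> carrier G" "x \<in> topspace M\<^sub>T"
  shows "\<phi> (h \<otimes> inv g) (\<phi> g x) = \<phi> h x"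
  using assms by (simp flip: composition_rule add: m_assoc)

text \<open>With an inverse in place of \<open>k\<close>, this is compatibility of the orbit functor
  with composition.\<close>

lemma mult_inv_telescope:
  assumes "g \<in> carrier G" "h \<in> carrier G" "k \<in> carrier G"
  shows "(h \<otimes> inv g) \<otimes> (g \<otimes> k) = h \<otimes> k"
proof -
  have "inv g \<otimes> (g \<otimes> k) = k"
    using assms by (simp flip: m_assoc)
  then show ?thesis
    using assms by (simp add: m_assoc)
qed

lemma mult_inv_shift:
  assumes "g \<in> carrier G" "h \<in> carrier G" "k \<in> carrier G"
  shows "(h \<otimes> inv k) \<otimes> inv (g \<otimes> inv k) = h \<otimes> inv g"
  using assms by (simp add: inv_mult_group mult_inv_telescope)

lemma continuous_map_mult:
  assumes "continuous_map Z G\<^sub>T f" "continuous_map Z G\<^sub>T g"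
  shows "continuous_map Z G\<^sub>T (\<lambda>z. f z \<otimes> g z)"
proof -
  have "continuous_map (prod_topology G\<^sub>T G\<^sub>T) G\<^sub>T (\<lambda>(g, h). g \<otimes> h)"
    using smooth_mult by (simp add: smooth_map_def prod_manifold_def)
  from continuous_map_compose[OF continuous_map_pairedI[OF assms] this] show ?thesis
    by (simp add: comp_def)
qed

lemma continuous_map_inv:
  assumes "continuous_map Z G\<^sub>T f"
  shows "continuous_map Z G\<^sub>T (\<lambda>z. inv f z)"
proof -
  have "continuous_map G\<^sub>T G\<^sub>T (\<lambda>g. inv g)"
    using smooth_inv by (simp add: smooth_map_def)
  from continuous_map_compose[OF assms this] show ?thesis
    by (simp add: comp_def)
qed

lemma continuous_map_action:
  assumes "continuous_map Z G\<^sub>T f" "continuous_map Z M\<^sub>T g"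
  shows "continuous_map Z M\<^sub>T (\<lambda>z. \<phi> (f z) (g z))"
proof -
  have "continuous_map (prod_topology G\<^sub>T M\<^sub>T) M\<^sub>T (\<lambda>(g, x). \<phi> g x)"
    using smooth by (simp add: smooth_map_def prod_manifold_def)
  from continuous_map_compose[OF continuous_map_pairedI[OF assms] this] show ?thesis
    by (simp add: comp_def)
qed

section \<open>The action and the levelwise quotient map\<close>

lemma simplicial_map_EG_simplex_action:
  assumes "g \<in> carrier G"
  shows "simplicial_map (nerve \<E>) (nerve \<E>) (EG_simplex_action g)"
  unfolding simplicial_map_def nerve_def EG_simplex_action_def using assms
  by (auto intro!: nerve_map_closed[where A = \<E>] nerve_map_nerve_face nerve_map_nerve_degen simp: carrier_eq)

lemma simplicial_map_orbit_simplex: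
  assumes x: "x \<in> topspace M\<^sub>T"
  shows "simplicial_map (nerve \<E>) (nerve \<A>) (\<lambda>n z. orbit_simplex n z x)"
  unfolding simplicial_map_def nerve_def orbit_simplex_def using x
  by (auto intro!: nerve_map_closed[where A = \<E>] nerve_map_nerve_face nerve_map_nerve_degen
      simp: carrier_eq action_closed action_shift mult_inv_telescope)

lemma continuous_map_orbit_simplex:
  "continuous_map (prod_topology (nerve_level \<E> n) M\<^sub>T) (nerve_level \<A> n) (\<lambda>(z, x). orbit_simplex n z x)"
proof (cases n)
  case 0
  let ?D = "prod_topology (nerve_level \<E> 0) M\<^sub>T"
  have "continuous_map ?D G\<^sub>T (\<lambda>w. projl (fst w))"
    using continuous_map_compose[OF continuous_map_fst continuous_map_projl_nerve_level[of \<E>]]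
    by (simp add: comp_def)
  then have "continuous_map ?D (nerve_level \<A> 0) (\<lambda>w. Inl (\<phi> (projl (fst w)) (snd w)))"
    by (intro continuous_map_Inl_nerve_level) (simp add: continuous_map_action continuous_map_snd)
  then show ?thesis
    unfolding 0 by (rule continuous_map_eq) (auto simp: orbit_simplex_def elim!: nerve_level_0E)
next
  case (Suc m)
  let ?D = "prod_topology (nerve_level \<E> (Suc m)) M\<^sub>T"
  have "continuous_map ?D (prod_topology G\<^sub>T G\<^sub>T) (\<lambda>w. projr (fst w) i)" if "i \<le> m" for i
    using continuous_map_compose[OF continuous_map_fst continuous_map_projr_nerve_level[of i m \<E>]] that
    by (simp add: comp_def)
  note c = continuous_map_fst_app[OF this] continuous_map_snd_app[OF this]
  \<comment> \<open>The \<open>i\<close>-th arrow of the image string, written by projections so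
    that continuity can be checked coordinatewise. It agrees with \<open>orbit_simplex\<close> on
    points of the level, which suffices for \<open>continuous_map_eq\<close>.\<close>
  let ?f = "\<lambda>i w. (snd (projr (fst w) i) \<otimes> inv (fst (projr (fst w) i)), \<phi> (fst (projr (fst w) i)) (snd w))"
  have "continuous_map ?D (nerve_level \<A> (Suc m)) (\<lambda>w. Inr (\<lambda>i\<in>{..<Suc m}. ?f i w))"
  proof (rule continuous_map_Inr_nerve_level)
    show "continuous_map ?D (mtop (garr \<A>)) (?f i)" if "i \<le> m" for i
      using c[OF that]
      by (auto intro!: continuous_map_pairedI continuous_map_mult continuous_map_inv
          continuous_map_action continuous_map_snd)
    fix i w assume i: "i < m" and w: "w \<in> topspace ?D"
    then obtain a where "fst w = Inr a" "\<And>i. i \<le> m \<Longrightarrow> a i \<in> carrier G \<times> carrier G"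
        "\<And>i. i < m \<Longrightarrow> snd (a i) = fst (a (Suc i))"
      by (auto simp: carrier_eq elim!: nerve_level_SucE)
    then show "gtgt \<A> (?f i w) = gsrc \<A> (?f (Suc i) w)"
      using w i by (auto simp: mem_Times_iff action_shift)
  qed
  then show ?thesis
    unfolding Suc
    by (rule continuous_map_eq)
      (auto simp: orbit_simplex_def case_prod_beta restrict_def fun_eq_iff elim!: nerve_level_SucE)
qed

section \<open>The continuous section\<close>

lemma path_product_closed:
  assumes "\<And>j. j < i \<Longrightarrow> fst (a j) \<in> carrier G"
  shows "path_product a i \<in> carrier G"
  using assms by (induction i) auto

lemma continuous_map_lift_simplex:
  "continuous_map (nerve_level \<A> n) (prod_topology (nerve_level \<E> n) M\<^sub>T) (lift_simplex n)"
proof (cases n)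
  case 0
  have "continuous_map (nerve_level \<A> 0) (prod_topology (nerve_level \<E> 0) M\<^sub>T) (\<lambda>y. (Inl \<one>, projl y))"
    using continuous_map_projl_nerve_level[of \<A>]
    by (intro continuous_map_pairedI continuous_map_Inl_nerve_level) (simp_all add: carrier_eq)
  then show ?thesis
    by (simp add: 0 lift_simplex_def[abs_def])
next
  case (Suc m)
  let ?D = "nerve_level \<A> (Suc m)"
  have c: "continuous_map ?D (prod_topology G\<^sub>T M\<^sub>T) (\<lambda>y. projr y i)" if "i \<le> m" for i
    using continuous_map_projr_nerve_level[of i m \<A>] that by simp
  \<comment> \<open>Each vertex of the lift is a finite product of coordinates. The bound is
    \<open>Suc m\<close>, as a string has one more vertex than arrows.\<close>
  have p: "continuous_map ?D G\<^sub>T (\<lambda>y. path_product (projr y) i)" if "i \<le> Suc m" for i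
    using that by (induction i) (simp_all add: carrier_eq continuous_map_mult continuous_map_fst_app[OF c])
  have "continuous_map ?D (nerve_level \<E> (Suc m))
      (\<lambda>y. Inr (\<lambda>i\<in>{..<Suc m}. (path_product (projr y) i, path_product (projr y) (Suc i))))"
    using p by (intro continuous_map_Inr_nerve_level) (auto intro!: continuous_map_pairedI simp del: path_product.simps)
  then have "continuous_map ?D (prod_topology (nerve_level \<E> (Suc m)) M\<^sub>T)
      (\<lambda>y. (Inr (\<lambda>i\<in>{..<Suc m}. (path_product (projr y) i, path_product (projr y) (Suc i))), snd (projr y 0)))"
    by (rule continuous_map_pairedI) (simp add: continuous_map_snd_app[OF c])
  then show ?thesis
    by (simp add: Suc lift_simplex_def[abs_def])
qed

lemma orbit_simplex_lift_simplex:
  assumes "y \<in> topspace (nerve_level \<A> n)"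
  shows "(\<lambda>(z, x). orbit_simplex n z x) (lift_simplex n y) = y"
proof (cases n)
  case 0
  then show ?thesis
    using assms by (auto simp: orbit_simplex_def lift_simplex_def action_one elim!: nerve_level_0E)
next
  case (Suc m)
  then obtain a where y: "y = Inr a" and ext: "a \<in> extensional {..<Suc m}"
      and a: "\<And>i. i \<le> m \<Longrightarrow> fst (a i) \<in> carrier G" "\<And>i. i \<le> m \<Longrightarrow> snd (a i) \<in> topspace M\<^sub>T"
      "\<And>i. i < m \<Longrightarrow> \<phi> (fst (a i)) (snd (a i)) = snd (a (Suc i))"
    using assms by (auto simp: carrier_eq mem_Times_iff elim!: nerve_level_SucE)
  have P: "path_product a i \<in> carrier G" if "i \<le> m" for i
    using path_product_closed a that by simp
  \<comment> \<open>Composability carries the first vertex along the string: the \<open>i\<close>-th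
    vertex of the lift takes it to the source of \<open>a i\<close>.\<close>
  have vertex: "\<phi> (path_product a i) (snd (a 0)) = snd (a i)" if "i \<le> m" for i
    using that
  proof (induction i)
    case 0
    then show ?case
      using a by (simp add: action_one)
  next
    case (Suc i)
    then show ?case
      using a P by (simp add: composition_rule)
  qed
  have "(fst (a i) \<otimes> path_product a i \<otimes> inv path_product a i, \<phi> (path_product a i) (snd (a 0))) = a i"
    if "i \<le> m" for i
    using that a P vertex by (simp add: m_assoc)
  then show ?thesis
    using ext by (auto simp: Suc y orbit_simplex_def lift_simplex_def restrict_def fun_eq_iff extensional_def)
qed

section \<open>Fibres of the quotient map are orbits\<close>

lemma orbit_simplex_invariant:
  assumes g: "g \<in> carrier G" and z: "z \<in> topspace (nerve_level \<E> n)" and x: "x \<in> topspace M\<^sub>T"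
  shows "orbit_simplex n (EG_simplex_action g n z) (\<phi> g x) = orbit_simplex n z x"
  unfolding orbit_simplex_def EG_simplex_action_def nerve_map_nerve_map
  by (rule nerve_map_eqI[OF z]) (use g x in \<open>auto simp: carrier_eq action_shift mult_inv_shift\<close>)

text \<open>The first vertices of \<open>z\<close> and \<open>z'\<close> determine the group
  element. Equal group parts of corresponding arrows then force the same translation at all later
  vertices.\<close>

lemma orbit_simplex_fibre:
  assumes z: "z \<in> topspace (nerve_level \<E> n)" and x: "x \<in> topspace M\<^sub>T"
    and z': "z' \<in> topspace (nerve_level \<E> n)" and x': "x' \<in> topspace M\<^sub>T"
    and eq: "orbit_simplex n z x = orbit_simplex n z' x'"
  shows "\<exists>g \<in> carrier G. z' = EG_simplex_action g n z \<and> x' = \<phi> g x"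
proof -
  \<comment> \<open>The candidate is found by solving \<open>k \<otimes> inv g = k'\<close>; the
    same \<open>g\<close> moves \<open>x\<close> to \<open>x'\<close>.\<close>
  have base: "x' = \<phi> (inv k' \<otimes> k) x" "k \<otimes> inv (inv k' \<otimes> k) = k'"
    if "k \<in> carrier G" "k' \<in> carrier G" "\<phi> k x = \<phi> k' x'" for k k'
  proof -
    have "\<phi> (inv k' \<otimes> k) x = \<phi> (inv k') (\<phi> k' x')"
      using that x by (simp add: composition_rule)
    also have "\<dots> = x'"
      using that x' by (simp flip: composition_rule add: action_one)
    finally show "x' = \<phi> (inv k' \<otimes> k) x" ..
    show "k \<otimes> inv (inv k' \<otimes> k) = k'"
      using that by (simp add: inv_mult_group flip: m_assoc)
  qed
  show ?thesis
  proof (cases n)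
    case 0
    then obtain k k' where k: "z = Inl k" "z' = Inl k'" "k \<in> carrier G" "k' \<in> carrier G"
      using z z' by (auto simp: carrier_eq elim!: nerve_level_0E)
    then have "\<phi> k x = \<phi> k' x'"
      using eq 0 by (simp add: orbit_simplex_def)
    with k base show ?thesis
      by (intro bexI[of _ "inv k' \<otimes> k"]) (auto simp: EG_simplex_action_def)
  next
    case (Suc m)
    obtain a where a: "z = Inr a" "a \<in> extensional {..<Suc m}"
        "\<And>i. i \<le> m \<Longrightarrow> fst (a i) \<in> carrier G" "\<And>i. i \<le> m \<Longrightarrow> snd (a i) \<in> carrier G"
        "\<And>i. i < m \<Longrightarrow> snd (a i) = fst (a (Suc i))"
      using z by (auto simp: Suc carrier_eq mem_Times_iff elim!: nerve_level_SucE)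
    obtain a' where a': "z' = Inr a'" "a' \<in> extensional {..<Suc m}"
        "\<And>i. i \<le> m \<Longrightarrow> fst (a' i) \<in> carrier G" "\<And>i. i \<le> m \<Longrightarrow> snd (a' i) \<in> carrier G"
        "\<And>i. i < m \<Longrightarrow> snd (a' i) = fst (a' (Suc i))"
      using z' by (auto simp: Suc carrier_eq mem_Times_iff elim!: nerve_level_SucE)
    have "(\<lambda>i\<in>{..<Suc m}. (snd (a i) \<otimes> inv fst (a i), \<phi> (fst (a i)) x)) =
        (\<lambda>i\<in>{..<Suc m}. (snd (a' i) \<otimes> inv fst (a' i), \<phi> (fst (a' i)) x'))"
      using eq by (simp add: orbit_simplex_def a(1) a'(1) Suc case_prod_beta)
    then have eqs: "snd (a i) \<otimes> inv fst (a i) = snd (a' i) \<otimes> inv fst (a' i)"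
      "\<phi> (fst (a i)) x = \<phi> (fst (a' i)) x'" if "i \<le> m" for i
      using that by (auto simp: restrict_def fun_eq_iff split: if_splits)
    define g where "g = inv (fst (a' 0)) \<otimes> fst (a 0)"
    have g: "g \<in> carrier G" "x' = \<phi> g x" "fst (a' 0) = fst (a 0) \<otimes> inv g"
      using base[OF a(3) a'(3) eqs(2), of 0] a(3)[of 0] a'(3)[of 0] by (auto simp: g_def)
    \<comment> \<open>The translation passes from the source of an arrow to its target; the
      induction below then moves on to the next arrow by composability.\<close>
    have step: "snd (a' i) = snd (a i) \<otimes> inv g" if "i \<le> m" "fst (a' i) = fst (a i) \<otimes> inv g" for i
    proof -
      have "snd (a' i) = (snd (a' i) \<otimes> inv fst (a' i)) \<otimes> fst (a' i)"
        using a'(3,4)[OF that(1)] by (simp add: m_assoc)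
      also have "\<dots> = snd (a i) \<otimes> inv fst (a i) \<otimes> (fst (a i) \<otimes> inv g)"
        using eqs(1)[OF that(1)] that(2) by simp
      also have "\<dots> = snd (a i) \<otimes> inv g"
        using a(3,4)[OF that(1)] g(1) by (simp add: mult_inv_telescope)
      finally show ?thesis .
    qed
    have "fst (a' i) = fst (a i) \<otimes> inv g" if "i \<le> m" for i
      using that
    proof (induction i)
      case (Suc i)
      then have "snd (a' i) = snd (a i) \<otimes> inv g"
        using step by simp
      then show ?case
        using a(5)[of i] a'(5)[of i] Suc by simp
    qed (use g in simp)
    then have "a' i = map_prod (\<lambda>h. h \<otimes> inv g) (\<lambda>h. h \<otimes> inv g) (a i)" if "i \<le> m" for i
      using step that by (simp add: prod_eq_iff)
    then have "a' = (\<lambda>i\<in>{..<Suc m}. map_prod (\<lambda>h. h \<otimes> inv g) (\<lambda>h. h \<otimes> inv g) (a i))"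
      using a'(2) by (auto simp: restrict_def fun_eq_iff extensional_def)
    then show ?thesis
      using g by (auto simp: EG_simplex_action_def a(1) a'(1) Suc)
  qed
qed

section \<open>Application to the two nerves\<close>

sublocale simplicial_quotient G M\<^sub>T \<phi> "nerve \<E>" "nerve \<A>" EG_simplex_action orbit_simplex lift_simplex
proof unfold_locales
  show "locally_compact_space M\<^sub>T" "Hausdorff_space M\<^sub>T"
    by (rule base.locally_compact base.Hausdorff)+
  show "EG_simplex_action \<one> n z = z" if "z \<in> topspace (level (nerve \<E>) n)" for n z
  proof -
    have z: "z \<in> topspace (nerve_level \<E> n)"
      using that by (simp add: nerve_def)
    have "EG_simplex_action \<one> n z = nerve_map (\<lambda>x. x) (\<lambda>a. a) n z"
      unfolding EG_simplex_action_def by (rule nerve_map_eqI[OF z]) (auto simp: carrier_eq)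
    then show ?thesis
      using nerve_map_ident[OF z] by simp
  qed
  \<comment> \<open>Translating on the right by inverses gives a left action, because
    \<open>inv (g \<otimes> h) = inv h \<otimes> inv g\<close>.\<close>
  show "EG_simplex_action (g \<otimes> h) n z = EG_simplex_action g n (EG_simplex_action h n z)"
    if "g \<in> carrier G" "h \<in> carrier G" "z \<in> topspace (level (nerve \<E>) n)" for g h n z
  proof -
    have z: "z \<in> topspace (nerve_level \<E> n)"
      using that by (simp add: nerve_def)
    show ?thesis
      unfolding EG_simplex_action_def nerve_map_nerve_map
      by (rule nerve_map_eqI[OF z]) (use that in \<open>auto simp: carrier_eq inv_mult_group m_assoc\<close>)
  qed
qed (simp_all add: nerve_def nerve_face_pair_groupoid_closed nerve_degen_pair_groupoid_closed
    simplicial_map_EG_simplex_action[unfolded nerve_def] simplicial_map_orbit_simplex[unfolded nerve_def]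
    continuous_map_orbit_simplex continuous_map_lift_simplex orbit_simplex_lift_simplex
    orbit_simplex_invariant orbit_simplex_fibre)

lemma classifying_space_homeomorphic_borel_construction:
  "classifying_space \<A> homeomorphic_space borel_construction G M \<phi>"
proof -
  \<comment> \<open>This identifies \<open>Borel_orbit\<close> with the orbit map in
    \<open>borel_construction\<close>.\<close>
  have "realisation_map (nerve \<E>) (EG_simplex_action g) = EG_action G g" for g
    by (simp add: EG_action_def EG_simplex_action_def Let_def)
  then show ?thesis
    using geometric_realisation_homeomorphic_Borel
    by (simp add: borel_construction_def classifying_space_def EG_def)
qed

end

theorem propositionB11:
  fixes G :: "'g smooth_group" and M :: "'m manifold" and \<phi> :: "'g \<Rightarrow> 'm \<Rightarrow> 'm"
  assumes "lie_group G" and "smooth_manifold M" and "smooth_action G M \<phi>"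
  shows "classifying_space (action_groupoid G M \<phi>) homotopy_equivalent_space
         borel_construction G M \<phi>"
proof -
  interpret lie_group_action G M \<phi>
    using assms by (simp add: lie_group_action_def)
  show ?thesis
    by (rule homeomorphic_imp_homotopy_equivalent_space[OF classifying_space_homeomorphic_borel_construction])
qed

end
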